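(* Let $d\ge1$ and let $\{(R_j,B_j,L_j):j\ge1\}$ be a Riesz sequence tower (with $R_j$ expanding $d\times d$ integer matrices and $B_j,L_j\subset\mathbb{Z}^d$ finite sets containing $0$). Assume that the associated infinite convolution measure $\mu=\mu(\{R_j,B_j\})$ satisfies the no-overlap condition and that, for each $j$, the elements of $B_j$ lie in pairwise distinct cosets of $R_j(\mathbb{Z}^d)$ in $\mathbb{Z}^d$. Suppose that there exists $j$ such that $\#L_j<\#B_j$. Then $\{e^{2\pi i\langle\lambda,x\rangle}:\lambda\in\Lambda\}$ is not complete in $L^2(\mu)$, where $\Lambda=\bigcup_{n\ge1}\Lambda_n$ and $\Lambda_n=L_1+R_1^{\mathtt T}L_2+\cdots+(R_1^{\mathtt T}R_2^{\mathtt T}\cdots R_{n-1}^{\mathtt T})L_n$.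
   Context: A square matrix is expanding if all its eigenvalues have modulus $>1$. $A^{\mathtt T}$ denotes the transpose. Infinite products are limits of partial products. A family is complete in $L^2(\mu)$ if its linear span is dense. Towers. For an expanding integer matrix $R$ and finite $B,L\subset\mathbb{Z}^d$ with $0\in B\cap L$, put $\mathbf{e}_{R,\lambda}=\frac{1}{\sqrt{\#B}}\big(e^{2\pi i\langle R^{-1}b,\lambda\rangle}\big)_{b\in B}\in\mathbb{C}^{\#B}$. $(R,B,L)$ is a Riesz sequence triple with bounds $C\le D$ if $C\sum_{\lambda\in L}|a_\lambda|^2\le\|\sum_{\lambda\in L}a_\lambda\mathbf{e}_{R,\lambda}\|^2\le D\sum_{\lambda\in L}|a_\lambda|^2$ for all $(a_\lambda)\in\mathbb{C}^{\#L}$. $\{(R_j,B_j,L_j)\}_{j\ge1}$ is a Riesz sequence tower if there are $0<C_j\le D_j<\infty$ with $\prod_j C_j>0$ and $\prod_j D_j<\infty$ such that each $(R_j,B_j,L_j)$ is a Riesz sequence triple with bounds $C_j,D_j$. Measure. $\mathbf{R}_n=R_nR_{n-1}\cdots R_1$; for a finite set $A$, $\delta_A=\frac{1}{\#A}\sum_{a\in A}\delta_a$ ($\delta_a$ the Dirac mass at $a$). $\mu=\delta_{\mathbf{R}_1^{-1}B_1}*\delta_{\mathbf{R}_2^{-1}B_2}*\cdots$, the infinite convolution being assumed to converge weakly to a Borel probability measure. $\mathbf{B}_n=\mathbf{R}_n\{\sum_{k=1}^n\mathbf{R}_k^{-1}b_k:b_k\in B_k\}$ and $K_n=\{\sum_{k=n+1}^\infty\mathbf{R}_k^{-1}b_k:b_k\in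 B_k\}$ (all these series are assumed to converge). No-overlap condition: $\mu\big((\mathbf{R}_n^{-1}\mathbf{b}+K_n)\cap(\mathbf{R}_n^{-1}\mathbf{b}'+K_n)\big)=0$ for all $\mathbf{b}\ne\mathbf{b}'$ in $\mathbf{B}_n$ and all $n\ge1$. *)

theory Defs
  imports "HOL-Probability.Probability"
begin

text \<open>
  All sequences of matrices and digit sets are functions on \<^typ>\<open>nat\<close> of which only the
  values at indices \<open>j \<ge> 1\<close> are used. The dimension \<open>d\<close> is the cardinality of the
  finite index type \<open>'n\<close>.
\<close>

definition real_vec :: "int ^ 'n \<Rightarrow> real ^ 'n" where
  "real_vec v = (\<chi> i. real_of_int (v $ i))"

definition inv_app :: "int ^ 'n ^ 'n \<Rightarrow> real ^ 'n \<Rightarrow> real ^ 'n" where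
  "inv_app R x = matrix_inv (map_matrix real_of_int R) *v x"

definition expanding :: "int ^ 'n ^ 'n \<Rightarrow> bool" where
  "expanding R \<longleftrightarrow>
     (\<forall>(z::complex) v. v \<noteq> 0 \<and> map_matrix of_int R *v v = z *s v \<longrightarrow> cmod z > 1)"

definition riesz_vec ::
    "int ^ 'n ^ 'n \<Rightarrow> (int ^ 'n) set \<Rightarrow> int ^ 'n \<Rightarrow> int ^ 'n \<Rightarrow> complex" where
  "riesz_vec R B l b = complex_of_real (1 / sqrt (real (card B))) *
     exp (2 * complex_of_real pi * \<i> *
          complex_of_real (inv_app R (real_vec b) \<bullet> real_vec l))"

definition riesz_triple ::
    "int ^ 'n ^ 'n \<Rightarrow> (int ^ 'n) set \<Rightarrow> (int ^ 'n) set \<Rightarrow> real \<Rightarrow> real \<Rightarrow> bool" where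
  "riesz_triple R B L C D \<longleftrightarrow>
     expanding R \<and> finite B \<and> finite L \<and> 0 \<in> B \<inter> L \<and> C \<le> D \<and>
     (\<forall>a :: int ^ 'n \<Rightarrow> complex.
        C * (\<Sum>l\<in>L. (cmod (a l))\<^sup>2) \<le> (\<Sum>b\<in>B. (cmod (\<Sum>l\<in>L. a l * riesz_vec R B l b))\<^sup>2) \<and>
        (\<Sum>b\<in>B. (cmod (\<Sum>l\<in>L. a l * riesz_vec R B l b))\<^sup>2) \<le> D * (\<Sum>l\<in>L. (cmod (a l))\<^sup>2))"

text \<open>The infinite products are limits of partial products.\<close>

definition riesz_tower ::
    "(nat \<Rightarrow> int ^ 'n ^ 'n) \<Rightarrow> (nat \<Rightarrow> (int ^ 'n) set) \<Rightarrow> (nat \<Rightarrow> (int ^ 'n) set) \<Rightarrow> bool" where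
  "riesz_tower R B L \<longleftrightarrow>
     (\<exists>C D :: nat \<Rightarrow> real.
        (\<forall>j\<ge>1. 0 < C j \<and> C j \<le> D j \<and> riesz_triple (R j) (B j) (L j) (C j) (D j)) \<and>
        (\<exists>p>0. (\<lambda>n. \<Prod>j=1..n. C j) \<longlonglongrightarrow> p) \<and>
        (\<exists>q. (\<lambda>n. \<Prod>j=1..n. D j) \<longlonglongrightarrow> q))"

text \<open>\<open>R\<^sub>n R\<^sub>n\<^sub>-\<^sub>1 \<cdots> R\<^sub>1\<close>\<close>

primrec mat_prod :: "(nat \<Rightarrow> int ^ 'n ^ 'n) \<Rightarrow> nat \<Rightarrow> int ^ 'n ^ 'n" where
  "mat_prod R 0 = mat 1"
| "mat_prod R (Suc n) = R (Suc n) ** mat_prod R n"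

text \<open>\<open>R\<^sub>1\<^sup>T R\<^sub>2\<^sup>T \<cdots> R\<^sub>n\<^sup>T\<close>\<close>

primrec transpose_prod :: "(nat \<Rightarrow> int ^ 'n ^ 'n) \<Rightarrow> nat \<Rightarrow> int ^ 'n ^ 'n" where
  "transpose_prod R 0 = mat 1"
| "transpose_prod R (Suc n) = transpose_prod R n ** transpose (R (Suc n))"

definition freq_level ::
    "(nat \<Rightarrow> int ^ 'n ^ 'n) \<Rightarrow> (nat \<Rightarrow> (int ^ 'n) set) \<Rightarrow> nat \<Rightarrow> (int ^ 'n) set" where
  "freq_level R L n =
     {\<Sum>k=1..n. transpose_prod R (k - 1) *v l k | l. \<forall>k\<in>{1..n}. l k \<in> L k}"

definition freq_set ::
    "(nat \<Rightarrow> int ^ 'n ^ 'n) \<Rightarrow> (nat \<Rightarrow> (int ^ 'n) set) \<Rightarrow> (int ^ 'n) set" where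
  "freq_set R L = (\<Union>n\<in>{1..}. freq_level R L n)"

definition scaled_digit ::
    "(nat \<Rightarrow> int ^ 'n ^ 'n) \<Rightarrow> nat \<Rightarrow> int ^ 'n \<Rightarrow> real ^ 'n" where
  "scaled_digit R k b = inv_app (mat_prod R k) (real_vec b)"

text \<open>For a nonempty finite set \<open>A\<close>, the normalised sum of Dirac masses as a Borel measure.\<close>

definition unif_dirac :: "(real ^ 'n) set \<Rightarrow> (real ^ 'n) measure" where
  "unif_dirac A = distr (measure_pmf (pmf_of_set A)) borel (\<lambda>x. x)"

text \<open>The partial convolutions, starting from the neutral element, the Dirac mass at the origin.\<close>

primrec partial_conv ::
    "(nat \<Rightarrow> int ^ 'n ^ 'n) \<Rightarrow> (nat \<Rightarrow> (int ^ 'n) set) \<Rightarrow> nat \<Rightarrow> (real ^ 'n) measure" where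
  "partial_conv R B 0 = return borel 0"
| "partial_conv R B (Suc n) =
     convolution (partial_conv R B n) (unif_dirac (scaled_digit R (Suc n) ` B (Suc n)))"

definition weak_limit :: "(nat \<Rightarrow> (real ^ 'n) measure) \<Rightarrow> (real ^ 'n) measure \<Rightarrow> bool" where
  "weak_limit \<nu> \<mu> \<longleftrightarrow>
     (\<forall>f :: real ^ 'n \<Rightarrow> real. continuous_on UNIV f \<and> bounded (range f) \<longrightarrow>
        (\<lambda>n. integral\<^sup>L (\<nu> n) f) \<longlonglongrightarrow> integral\<^sup>L \<mu> f)"

definition infinite_convolution ::
    "(nat \<Rightarrow> int ^ 'n ^ 'n) \<Rightarrow> (nat \<Rightarrow> (int ^ 'n) set) \<Rightarrow> (real ^ 'n) measure \<Rightarrow> bool" where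
  "infinite_convolution R B \<mu> \<longleftrightarrow>
     prob_space \<mu> \<and> sets \<mu> = sets borel \<and> weak_limit (partial_conv R B) \<mu>"

definition digit_series_converge ::
    "(nat \<Rightarrow> int ^ 'n ^ 'n) \<Rightarrow> (nat \<Rightarrow> (int ^ 'n) set) \<Rightarrow> bool" where
  "digit_series_converge R B \<longleftrightarrow>
     (\<forall>n b. (\<forall>k>n. b k \<in> B k) \<longrightarrow>
        summable (\<lambda>i. scaled_digit R (n + 1 + i) (b (n + 1 + i))))"

definition tail_set ::
    "(nat \<Rightarrow> int ^ 'n ^ 'n) \<Rightarrow> (nat \<Rightarrow> (int ^ 'n) set) \<Rightarrow> nat \<Rightarrow> (real ^ 'n) set" where
  "tail_set R B n =
     {\<Sum>i. scaled_digit R (n + 1 + i) (b (n + 1 + i)) | b. \<forall>k>n. b k \<in> B k}"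

definition digit_level ::
    "(nat \<Rightarrow> int ^ 'n ^ 'n) \<Rightarrow> (nat \<Rightarrow> (int ^ 'n) set) \<Rightarrow> nat \<Rightarrow> (real ^ 'n) set" where
  "digit_level R B n =
     {map_matrix real_of_int (mat_prod R n) *v (\<Sum>k=1..n. scaled_digit R k (b k)) | b.
        \<forall>k\<in>{1..n}. b k \<in> B k}"

text \<open>
  The intersections are automatically Borel: since \<open>0 \<in> B k\<close> and all digit series converge,
  they converge uniformly over all choices of digits, so the tail sets are compact. Hence membership
  in \<^const>\<open>null_sets\<close> says no more than that the measure vanishes.
\<close>

definition no_overlap ::
    "(nat \<Rightarrow> int ^ 'n ^ 'n) \<Rightarrow> (nat \<Rightarrow> (int ^ 'n) set) \<Rightarrow> (real ^ 'n) measure \<Rightarrow> bool" where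
  "no_overlap R B \<mu> \<longleftrightarrow>
     (\<forall>n\<ge>1. \<forall>b\<in>digit_level R B n. \<forall>b'\<in>digit_level R B n. b \<noteq> b' \<longrightarrow>
        ((+) (inv_app (mat_prod R n) b) ` tail_set R B n) \<inter>
        ((+) (inv_app (mat_prod R n) b') ` tail_set R B n) \<in> null_sets \<mu>)"

definition distinct_cosets :: "int ^ 'n ^ 'n \<Rightarrow> (int ^ 'n) set \<Rightarrow> bool" where
  "distinct_cosets R B \<longleftrightarrow> inj_on (\<lambda>b. (+) b ` range ((*v) R)) B"

definition in_L2 :: "'a measure \<Rightarrow> ('a \<Rightarrow> complex) \<Rightarrow> bool" where
  "in_L2 M f \<longleftrightarrow> f \<in> borel_measurable M \<and> integrable M (\<lambda>x. (cmod (f x))\<^sup>2)"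

text \<open>
  Density in \<open>L\<^sup>2(M)\<close> of the linear span of the family \<open>(e i)\<close>, \<open>i \<in> I\<close>, of
  square-integrable functions, expressed with representatives of \<open>L\<^sup>2\<close>-classes.
\<close>

definition complete_in_L2 :: "'a measure \<Rightarrow> 'i set \<Rightarrow> ('i \<Rightarrow> 'a \<Rightarrow> complex) \<Rightarrow> bool" where
  "complete_in_L2 M I e \<longleftrightarrow>
     (\<forall>f. in_L2 M f \<longrightarrow> (\<forall>\<epsilon>>0. \<exists>F c. finite F \<and> F \<subseteq> I \<and>
        (\<integral>\<^sup>+x. ennreal ((cmod (f x - (\<Sum>i\<in>F. c i * e i x)))\<^sup>2) \<partial>M) < ennreal (\<epsilon>\<^sup>2)))"

definition exponential :: "int ^ 'n \<Rightarrow> real ^ 'n \<Rightarrow> complex" where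
  "exponential l x = exp (2 * complex_of_real pi * \<i> * complex_of_real (real_vec l \<bullet> x))"

end

theory Submission
  imports Defs
begin

text \<open>
  Fix \<open>n\<close> with \<open>card (L n) < card (B n)\<close>. The lower Riesz bounds give \<open>card (L k) \<le> card (B k)\<close> for
  every \<open>k\<close>, so \<open>\<Lambda>\<^sub>n\<close> has fewer elements than there are digit words \<open>\<beta>\<close> of length \<open>n\<close>. With
  \<open>s(\<beta>) = \<Sum>\<^sub>k R\<^sub>1\<inverse> \<dots> R\<^sub>k\<inverse> \<beta>\<^sub>k\<close>, some nonzero weights \<open>c(\<beta>)\<close> therefore satisfy
  \<open>\<Sum>\<^sub>\<beta> c(\<beta>) e\<^sub>\<lambda>(s(\<beta>)) = 0\<close> for all \<open>\<lambda> \<in> \<Lambda>\<^sub>n\<close>, and then for all \<open>\<lambda> \<in> \<Lambda>\<close>, because \<open>e\<^sub>\<lambda>(s(\<beta>))\<close> does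
  not see the frequencies beyond level \<open>n\<close>. Realise \<open>\<mu>\<close> as the law of the random digit series
  \<open>s(\<beta>) + Y\<close> with \<open>Y\<close> independent of the first \<open>n\<close> digits. By the no-overlap condition the function
  with value \<open>cnj (c(\<beta>))\<close> on the cell \<open>s(\<beta>) + K\<^sub>n\<close> is almost surely determined by \<open>\<beta>\<close>, so its inner
  product with \<open>e\<^sub>\<lambda>\<close> is a multiple of \<open>\<Sum>\<^sub>\<beta> c(\<beta>) e\<^sub>\<lambda>(s(\<beta>)) = 0\<close>, although the function is nonzero.
\<close>

section \<open>Linear algebra and finite levels\<close>

lemma underdetermined_system:
  fixes M :: "'x \<Rightarrow> 'y \<Rightarrow> 'a::field"
  assumes "finite X" "finite Y" "card X < card Y"
  shows "\<exists>c. (\<exists>y\<in>Y. c y \<noteq> 0) \<and> (\<forall>x\<in>X. (\<Sum>y\<in>Y. c y * M x y) = 0)"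
  using assms
proof (induction X arbitrary: Y M rule: finite_induct)
  case empty
  then obtain y where "y \<in> Y" by fastforce
  then show ?case by (intro exI[of _ "\<lambda>_. 1"]) auto
next
  case (insert x X)
  show ?case
  proof (cases "\<forall>y\<in>Y. M x y = 0")
    case True
    have "card X < card Y" using insert by simp
    from insert.IH[OF \<open>finite Y\<close> this, of M] obtain c where
      "\<exists>y\<in>Y. c y \<noteq> 0" "\<forall>x\<in>X. (\<Sum>y\<in>Y. c y * M x y) = 0" by auto
    then show ?thesis using True by (intro exI[of _ c]) auto
  next
    case False
    then obtain y0 where y0: "y0 \<in> Y" "M x y0 \<noteq> 0" by blast
    let ?Y = "Y - {y0}"
    have "card X < card ?Y" using insert y0 by (simp add: card_Diff_singleton)
    \<comment> \<open>Row \<open>x\<close> is solved for the unknown at \<open>y0\<close> and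
      substituted into every other row; these are the resulting coefficients.\<close>
    from insert.IH[OF _ this, of "\<lambda>z y. M z y - M z y0 * M x y / M x y0"] \<open>finite Y\<close>
    obtain c where c: "\<exists>y\<in>?Y. c y \<noteq> 0"
      "\<And>z. z \<in> X \<Longrightarrow> (\<Sum>y\<in>?Y. c y * (M z y - M z y0 * M x y / M x y0)) = 0" by auto
    \<comment> \<open>Back substitution: the value at \<open>y0\<close> that makes row
      \<open>x\<close> vanish.\<close>
    define r where "r = - (\<Sum>y\<in>?Y. c y * M x y) / M x y0"
    define c' where "c' = c(y0 := r)"
    have sum: "(\<Sum>y\<in>Y. c' y * M z y) = r * M z y0 + (\<Sum>y\<in>?Y. c y * M z y)" for z
      using \<open>finite Y\<close> y0 by (subst sum.remove[of _ y0]) (auto simp: c'_def intro!: sum.cong)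
    have "(\<Sum>y\<in>Y. c' y * M z y) = 0" if "z \<in> X" for z
    proof -
      have "(\<Sum>y\<in>?Y. c y * M z y) - M z y0 / M x y0 * (\<Sum>y\<in>?Y. c y * M x y) = 0"
        using c(2)[OF that]
        by (simp add: sum_distrib_left sum_subtractf algebra_simps)
      then show ?thesis unfolding sum r_def by (simp add: field_simps)
    qed
    moreover have "(\<Sum>y\<in>Y. c' y * M x y) = 0"
      using y0 unfolding sum r_def by simp
    moreover have "\<exists>y\<in>Y. c' y \<noteq> 0"
      using c(1) by (auto simp: c'_def)
    ultimately show ?thesis by (intro exI[of _ c']) auto
  qed
qed

text \<open>With more frequencies than digits, the vectors \<open>riesz_vec R B l\<close> would be
  linearly dependent, and the coefficients of a dependency violate a positive lower bound.\<close>

lemma riesz_triple_card_le: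
  assumes "riesz_triple R B L C D" "C > 0"
  shows "card L \<le> card B"
proof (rule ccontr)
  assume "\<not> card L \<le> card B"
  moreover have fin: "finite B" "finite L" using assms by (auto simp: riesz_triple_def)
  ultimately obtain a where a: "\<exists>l\<in>L. a l \<noteq> 0"
    "\<forall>b\<in>B. (\<Sum>l\<in>L. a l * riesz_vec R B l b) = 0"
    using underdetermined_system[of B L "\<lambda>b l. riesz_vec R B l b"] by auto
  have "C * (\<Sum>l\<in>L. (cmod (a l))\<^sup>2) \<le> (\<Sum>b\<in>B. (cmod (\<Sum>l\<in>L. a l * riesz_vec R B l b))\<^sup>2)"
    using assms by (auto simp: riesz_triple_def)
  also have "\<dots> = 0" using a by simp
  finally have "(\<Sum>l\<in>L. (cmod (a l))\<^sup>2) \<le> 0"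
    using \<open>C > 0\<close> by (simp add: mult_le_0_iff)
  then have "(\<Sum>l\<in>L. (cmod (a l))\<^sup>2) = 0"
    by (intro antisym sum_nonneg) auto
  then show False using a fin by (auto simp: sum_nonneg_eq_0_iff)
qed

section \<open>Integer matrices and exponentials\<close>

abbreviation real_mat :: "int ^ 'n ^ 'm \<Rightarrow> real ^ 'n ^ 'm" where
  "real_mat \<equiv> map_matrix real_of_int"

lemma real_vec_simps [simp]:
  "real_vec 0 = 0" "real_vec (v + w) = real_vec v + real_vec w"
  "real_vec (v - w) = real_vec v - real_vec w"
  "real_vec v = real_vec w \<longleftrightarrow> v = w"
  by (auto simp: real_vec_def vec_eq_iff)

lemma real_vec_mult: "real_vec (A *v v) = real_mat A *v real_vec v"
  by (simp add: real_vec_def vec_eq_iff matrix_vector_mult_def map_matrix_def)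

lemma real_mat_mult: "real_mat (A ** B) = real_mat A ** real_mat B"
  by (simp add: vec_eq_iff matrix_matrix_mult_def map_matrix_def)

lemma real_mat_transpose: "real_mat (transpose A) = transpose (real_mat A)"
  by (simp add: vec_eq_iff transpose_def map_matrix_def)

text \<open>A nonzero real kernel vector, read as a complex vector, would be an eigenvector for the
  eigenvalue 0, whose modulus is not above 1.\<close>

lemma expanding_imp_invertible:
  fixes R :: "int ^ 'n ^ 'n"
  assumes "expanding R"
  shows "invertible (real_mat R)"
proof -
  have "v = 0" if v: "real_mat R *v v = 0" for v
  proof (rule ccontr)
    assume "v \<noteq> 0"
    let ?w = "(\<chi> i. complex_of_real (v $ i)) :: complex ^ 'n"
    have "?w \<noteq> 0" using \<open>v \<noteq> 0\<close> by (auto simp: vec_eq_iff)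
    moreover have "map_matrix of_int R *v ?w = 0 *s ?w"
    proof -
      have "(map_matrix of_int R *v ?w) $ i = complex_of_real ((real_mat R *v v) $ i)" for i
        by (simp add: matrix_vector_mult_def map_matrix_def)
      then show ?thesis using v by (simp add: vec_eq_iff)
    qed
    ultimately have "cmod 0 > 1" using assms unfolding expanding_def by blast
    then show False by simp
  qed
  then show ?thesis
    using invertible_left_inverse matrix_left_invertible_ker by blast
qed

lemma inv_app_cancel:
  assumes "invertible (real_mat R)"
  shows "inv_app R (real_mat R *v x) = x" "real_mat R *v inv_app R x = x"
proof -
  have "real_mat R ** matrix_inv (real_mat R) = mat 1 \<and> matrix_inv (real_mat R) ** real_mat R = mat 1"
    using assms unfolding invertible_def matrix_inv_def by (rule someI_ex)
  then show "inv_app R (real_mat R *v x) = x" "real_mat R *v inv_app R x = x"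
    by (simp_all add: inv_app_def matrix_vector_mul_assoc)
qed

lemma inv_app_linear: "linear (inv_app R)"
  unfolding inv_app_def[abs_def] by (rule matrix_vector_mul_linear)

lemma transpose_prod_eq: "transpose_prod R n = transpose (mat_prod R n)"
  by (induction n) (simp_all add: matrix_transpose_mul)

lemma exponential_add_left: "exponential (l + l') x = exponential l x * exponential l' x"
  by (simp add: exponential_def inner_add_left algebra_simps flip: exp_add)

lemma exponential_add_right: "exponential l (x + y) = exponential l x * exponential l y"
  by (simp add: exponential_def inner_add_right algebra_simps flip: exp_add)

lemma norm_exponential [simp]: "cmod (exponential l x) = 1"
  by (simp add: exponential_def)

lemma continuous_on_exponential [continuous_intros]: "continuous_on A (exponential l)"
  unfolding exponential_def[abs_def] by (intro continuous_intros)

lemma borel_measurable_exponential [measurable]: "exponential l \<in> borel_measurable borel"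
  by (intro borel_measurable_continuous_onI continuous_intros)

text \<open>Moving \<open>A\<close> to the other side of the inner product pairs two integer
  vectors, so the exponent is an integer multiple of 2 pi i.\<close>

lemma exponential_periodic:
  assumes "real_mat A *v x = real_vec d"
  shows "exponential (transpose A *v w) x = 1"
proof -
  have "real_vec (transpose A *v w) \<bullet> x = real_vec w \<bullet> (real_mat A *v x)"
    by (metis real_vec_mult real_mat_transpose dot_lmul_matrix transpose_matrix_vector)
  also have "\<dots> = real_of_int (\<Sum>i\<in>UNIV. w $ i * d $ i)" (is "_ = real_of_int ?N")
    by (simp add: assms real_vec_def inner_vec_def)
  finally have "exponential (transpose A *v w) x = exp (\<i> * (of_int ?N * (of_real pi * 2)))"
    by (simp only: exponential_def) (simp add: mult_ac)
  then show ?thesis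
    by (simp only: exp_2pi_1_int)
qed

section \<open>Integer digit expansions\<close>

lemma mat_prod_factor:
  assumes "n \<le> m"
  shows "\<exists>Q. mat_prod R m = Q ** mat_prod R n"
  using assms
proof (induction m rule: dec_induct)
  case base
  show ?case by (rule exI[of _ "mat 1"]) simp
next
  case (step m)
  then show ?case by (auto simp: matrix_mul_assoc)
qed

text \<open>Horner's scheme for the image of \<open>partial_series R n \<beta>\<close> under
  \<open>mat_prod R n\<close>. Keeping it as an integer vector gives access both to the periodicity
  of exponentials and to cosets.\<close>

primrec digit_expansion :: "(nat \<Rightarrow> int ^ 'n ^ 'n) \<Rightarrow> nat \<Rightarrow> (nat \<Rightarrow> int ^ 'n) \<Rightarrow> int ^ 'n" where
  "digit_expansion R 0 \<beta> = 0"
| "digit_expansion R (Suc n) \<beta> = R (Suc n) *v digit_expansion R n \<beta> + \<beta> (Suc n)"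

definition partial_series :: "(nat \<Rightarrow> int ^ 'n ^ 'n) \<Rightarrow> nat \<Rightarrow> (nat \<Rightarrow> int ^ 'n) \<Rightarrow> real ^ 'n" where
  "partial_series R n \<beta> = (\<Sum>k=1..n. scaled_digit R k (\<beta> k))"

text \<open>For \<open>n = 0\<close> this is the whole digit series, whose law will turn out to be
  \<open>\<mu>\<close>.\<close>

definition tail_series :: "(nat \<Rightarrow> int ^ 'n ^ 'n) \<Rightarrow> nat \<Rightarrow> (nat \<Rightarrow> int ^ 'n) \<Rightarrow> real ^ 'n" where
  "tail_series R n \<beta> = (\<Sum>i. scaled_digit R (n + 1 + i) (\<beta> (n + 1 + i)))"

text \<open>\<open>zero_digit\<close> serves twice: it keeps the digit sets nonempty, so that
  uniform distributions on them make sense, and it upgrades convergence of all digit series to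
  absolute convergence.\<close>

locale digit_system =
  fixes R :: "nat \<Rightarrow> int ^ 'n ^ 'n" and B :: "nat \<Rightarrow> (int ^ 'n) set"
  assumes expanding: "j \<ge> 1 \<Longrightarrow> expanding (R j)"
    and finite_digits: "j \<ge> 1 \<Longrightarrow> finite (B j)"
    and zero_digit: "j \<ge> 1 \<Longrightarrow> 0 \<in> B j"
    and converge: "digit_series_converge R B"
begin

lemma invertible_mat_prod: "invertible (real_mat (mat_prod R n))"
proof (induction n)
  case 0
  have "real_mat (mat 1 :: int^'n^'n) = mat 1"
    by (simp add: vec_eq_iff mat_def map_matrix_def)
  then show ?case by (auto simp: invertible_def)
next
  case (Suc n)
  then show ?case
    by (simp add: real_mat_mult invertible_mult expanding_imp_invertible expanding)
qed

lemma real_mat_partial_series: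
  "real_mat (mat_prod R n) *v partial_series R n \<beta> = real_vec (digit_expansion R n \<beta>)"
proof (induction n)
  case 0
  show ?case by (simp add: partial_series_def)
next
  case (Suc n)
  have "partial_series R (Suc n) \<beta> = partial_series R n \<beta> + scaled_digit R (Suc n) (\<beta> (Suc n))"
    by (simp add: partial_series_def)
  then have "real_mat (mat_prod R (Suc n)) *v partial_series R (Suc n) \<beta> =
      real_mat (R (Suc n)) *v (real_mat (mat_prod R n) *v partial_series R n \<beta>)
      + real_vec (\<beta> (Suc n))"
    using inv_app_cancel(2)[OF invertible_mat_prod, of "Suc n"]
    by (simp add: matrix_vector_right_distrib real_mat_mult matrix_vector_mul_assoc scaled_digit_def)
  then show ?case by (simp add: Suc.IH real_vec_mult)
qed

lemma inj_int_mult: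
  assumes "j \<ge> 1" "R j *v v = R j *v w"
  shows "v = w"
proof -
  have "real_mat (R j) *v real_vec v = real_mat (R j) *v real_vec w"
    using assms(2) by (simp flip: real_vec_mult)
  then have "real_vec v = real_vec w"
    using inv_app_cancel(1)[OF expanding_imp_invertible[OF expanding[OF assms(1)]]] by metis
  then show ?thesis by simp
qed

text \<open>The expansion modulo the range of \<open>R n\<close> reveals the coset of the last
  digit, hence the digit itself. Subtracting it and cancelling the injective \<open>R n\<close>
  leaves the expansion of the shorter word.\<close>

lemma digit_expansion_inj:
  assumes "\<And>j. j \<ge> 1 \<Longrightarrow> distinct_cosets (R j) (B j)"
    and "\<And>k. k \<in> {1..n} \<Longrightarrow> \<beta> k \<in> B k" "\<And>k. k \<in> {1..n} \<Longrightarrow> \<gamma> k \<in> B k"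
    and "digit_expansion R n \<beta> = digit_expansion R n \<gamma>"
    and "k \<in> {1..n}"
  shows "\<beta> k = \<gamma> k"
  using assms(2-)
proof (induction n)
  case (Suc n)
  let ?u = "digit_expansion R n \<beta>" and ?v = "digit_expansion R n \<gamma>"
  have eq: "\<beta> (Suc n) + R (Suc n) *v ?u = \<gamma> (Suc n) + R (Suc n) *v ?v"
    using Suc.prems(3) by (simp add: add.commute)
  \<comment> \<open>One inclusion between cosets; the equation is symmetric, so it is used in both
    directions.\<close>
  have sub: "(+) b ` range ((*v) (R (Suc n))) \<subseteq> (+) c ` range ((*v) (R (Suc n)))"
    if "b + R (Suc n) *v u = c + R (Suc n) *v v" for b c u v
  proof
    fix x assume "x \<in> (+) b ` range ((*v) (R (Suc n)))"
    then obtain w where "x = b + R (Suc n) *v w" by auto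
    with that have "x = c + R (Suc n) *v (v - u + w)"
      by (simp add: matrix_vector_right_distrib matrix_vector_mult_diff_distrib algebra_simps)
    then show "x \<in> (+) c ` range ((*v) (R (Suc n)))" by blast
  qed
  have "(+) (\<beta> (Suc n)) ` range ((*v) (R (Suc n))) = (+) (\<gamma> (Suc n)) ` range ((*v) (R (Suc n)))"
    using sub[OF eq] sub[OF eq[symmetric]] by blast
  moreover have "\<beta> (Suc n) \<in> B (Suc n)" "\<gamma> (Suc n) \<in> B (Suc n)"
    using Suc.prems by auto
  ultimately have last: "\<beta> (Suc n) = \<gamma> (Suc n)"
    using assms(1)[of "Suc n"] unfolding distinct_cosets_def by (auto dest: inj_onD)
  then have "?u = ?v" using eq inj_int_mult[of "Suc n"] by simp
  then show ?case using Suc last by (cases "k = Suc n") auto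
qed simp

end

section \<open>Compactness of the tail sets\<close>

lemma continuous_on_real_vec: "continuous_on A real_vec"
proof -
  have "continuous_on UNIV real_of_int" by (intro continuous_intros)
  then show ?thesis unfolding real_vec_def[abs_def]
    by (intro continuous_intros)
qed

text \<open>This gives uniqueness of weak limits. Closed sets form an intersection-stable generator
  of the Borel sets, and the indicator of a nonempty closed set is a pointwise limit of bounded
  continuous functions.\<close>

lemma measure_eqI_continuous_bounded:
  fixes M N :: "'a::metric_space measure"
  assumes "prob_space M" "prob_space N" and sets: "sets M = sets borel" "sets N = sets borel"
    and eq: "\<And>f. continuous_on UNIV f \<Longrightarrow> bounded (range f) \<Longrightarrow>
      integral\<^sup>L M f = (integral\<^sup>L N f :: real)"
  shows "M = N"
proof (rule measure_eqI_generator_eq[where E="{S. closed S}" and \<Omega>=UNIV and A="\<lambda>_. UNIV"])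
  interpret M: prob_space M by fact
  interpret N: prob_space N by fact
  note [measurable_cong] = sets
  show "Int_stable {S. closed S}" by (auto simp: Int_stable_def)
  show "sets M = sigma_sets UNIV {S. closed S}" "sets N = sigma_sets UNIV {S. closed S}"
    using sets by (simp_all add: borel_eq_closed)
  fix S :: "'a set" assume "S \<in> {S. closed S}"
  then have S: "closed S" by simp
  show "emeasure M S = emeasure N S"
  \<comment> \<open>The empty set is treated apart because \<open>infdist x {}\<close> is 0 by
    convention, which would make every \<open>f k\<close> constantly 1.\<close>
  proof (cases "S = {}")
    case False
    define f where "f k x = max 0 (1 - real k * infdist x S)" for k x
    have cont: "continuous_on UNIV (f k)" for k
      unfolding f_def by (intro continuous_intros)
    have bd: "\<bar>f k x\<bar> \<le> 1" for k x
      using infdist_nonneg[of x S] by (simp add: f_def)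
    have lim: "(\<lambda>k. f k x) \<longlonglongrightarrow> indicator S x" for x
    proof (cases "x \<in> S")
      case True
      then show ?thesis by (simp add: f_def)
    next
      case x: False
      then have pos: "infdist x S > 0"
        using S False by (intro infdist_pos_not_in_closed)
      obtain K where K: "real K > 1 / infdist x S" using reals_Archimedean2 by blast
      have "f k x = 0" if "k \<ge> K" for k
      proof -
        have "real k > 1 / infdist x S" using K that by linarith
        then show ?thesis using pos by (simp add: f_def field_simps)
      qed
      then have "eventually (\<lambda>k. f k x = 0) sequentially"
        by (auto simp: eventually_sequentially)
      then show ?thesis using x by (simp add: tendsto_eventually)
    qed
    have int: "(\<lambda>k. integral\<^sup>L K (f k)) \<longlonglongrightarrow> measure K S"
      if "prob_space K" "sets K = sets borel" for K
    proof -
      interpret K: prob_space K by fact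
      note [measurable_cong] = that(2)
      have "(\<lambda>k. integral\<^sup>L K (f k)) \<longlonglongrightarrow> integral\<^sup>L K (indicator S)"
      proof (rule integral_dominated_convergence[where w="\<lambda>_. 1"])
        show "f k \<in> borel_measurable K" for k
          using borel_measurable_continuous_onI[OF cont] that(2) by simp
        show "(indicator S :: 'a \<Rightarrow> real) \<in> borel_measurable K"
          using S that(2) by (intro borel_measurable_indicator) simp
      qed (use lim bd in auto)
      moreover have "S \<in> sets K" using S that(2) by simp
      moreover then have "S \<inter> space K = S" using sets.sets_into_space by blast
      ultimately show ?thesis by simp
    qed
    have "bounded (range (f k))" for k
      using bd unfolding bounded_iff by (auto intro!: exI[of _ 1])
    then have "integral\<^sup>L M (f k) = integral\<^sup>L N (f k)" for k
      using cont eq by blast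
    then have "measure M S = measure N S"
      using int[OF assms(1) sets(1)] int[OF assms(2) sets(2)] LIMSEQ_unique by simp
    then show ?thesis by (simp add: M.emeasure_eq_measure N.emeasure_eq_measure)
  qed simp
qed (use prob_space.emeasure_space_1[OF assms(1)] sets_eq_imp_space_eq[OF sets(1)] in auto)

context digit_system
begin

lemma continuous_on_scaled_digit: "continuous_on A (scaled_digit R k)"
  unfolding scaled_digit_def[abs_def]
  by (intro continuous_on_compose2[OF linear_continuous_on[OF linear_conv_bounded_linear[THEN iffD1, OF inv_app_linear]]
        continuous_on_real_vec]) auto

text \<open>
  Choosing digits that maximise, respectively minimise, a fixed coordinate turns convergence of all
  digit series into absolute convergence, because \<open>0\<close> is a digit at every level.
\<close>

lemma digit_bound:
  obtains M where "summable M" "\<And>i b. b \<in> B (Suc i) \<Longrightarrow> norm (scaled_digit R (Suc i) b) \<le> M i"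
proof -
  have ex: "\<exists>b\<in>B k. \<forall>c\<in>B k. g c \<le> g b" if "k \<ge> 1" for k and g :: "int^'n \<Rightarrow> real"
  proof -
    have "Max (g ` B k) \<in> g ` B k"
      using finite_digits[OF that] zero_digit[OF that] by (intro Max_in) auto
    moreover have "g c \<le> Max (g ` B k)" if "c \<in> B k" for c
      using that finite_digits[OF \<open>k \<ge> 1\<close>] by simp
    ultimately show ?thesis by fastforce
  qed
  have "\<exists>hi. \<forall>k\<ge>1. hi k \<in> B k \<and> (\<forall>c\<in>B k. scaled_digit R k c $ i \<le> scaled_digit R k (hi k) $ i)" for i
    using ex[of _ "\<lambda>c. scaled_digit R _ c $ i"] by (intro choice) blast
  then obtain hi where hi: "\<And>i k. k \<ge> 1 \<Longrightarrow> hi i k \<in> B k"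
    "\<And>i k c. k \<ge> 1 \<Longrightarrow> c \<in> B k \<Longrightarrow> scaled_digit R k c $ i \<le> scaled_digit R k (hi i k) $ i"
    by metis
  have "\<exists>lo. \<forall>k\<ge>1. lo k \<in> B k \<and> (\<forall>c\<in>B k. - scaled_digit R k c $ i \<le> - scaled_digit R k (lo k) $ i)" for i
    using ex[of _ "\<lambda>c. - scaled_digit R _ c $ i"] by (intro choice) blast
  then obtain lo where lo: "\<And>i k. k \<ge> 1 \<Longrightarrow> lo i k \<in> B k"
    "\<And>i k c. k \<ge> 1 \<Longrightarrow> c \<in> B k \<Longrightarrow> scaled_digit R k (lo i k) $ i \<le> scaled_digit R k c $ i"
    by (metis neg_le_iff_le)
  have zero: "scaled_digit R k 0 = 0" for k
    using linear_0[OF inv_app_linear] by (simp add: scaled_digit_def)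
  have summ: "summable (\<lambda>j. scaled_digit R (Suc j) (b (Suc j)) $ i)" if "\<And>k. k \<ge> 1 \<Longrightarrow> b k \<in> B k" for b i
  proof -
    have "summable (\<lambda>j. scaled_digit R (0 + 1 + j) (b (0 + 1 + j)))"
      using converge that unfolding digit_series_converge_def by (metis One_nat_def Suc_leI)
    from bounded_linear.summable[OF bounded_linear_vec_nth this, of i] show ?thesis by simp
  qed
  \<comment> \<open>The widths of the coordinate ranges at level \<open>Suc j\<close>, added up.
    Since 0 is a digit, each range contains 0, so its width bounds the absolute value of the
    coordinate of every digit.\<close>
  define M where "M j = (\<Sum>i\<in>UNIV. scaled_digit R (Suc j) (hi i (Suc j)) $ i
    - scaled_digit R (Suc j) (lo i (Suc j)) $ i)" for j
  show ?thesis
  proof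
    show "summable M" unfolding M_def[abs_def]
      by (intro summable_sum summable_diff summ hi lo)
    fix j b assume b: "b \<in> B (Suc j)"
    let ?s = "scaled_digit R (Suc j)"
    have "norm (?s b) \<le> (\<Sum>i\<in>UNIV. \<bar>?s b $ i\<bar>)" by (rule norm_le_l1_cart)
    also have "\<dots> \<le> M j" unfolding M_def
    proof (rule sum_mono)
      fix i
      have "?s (lo i (Suc j)) $ i \<le> ?s b $ i" "?s b $ i \<le> ?s (hi i (Suc j)) $ i"
        using hi(2)[of "Suc j" b i] lo(2)[of "Suc j" b i] b by auto
      moreover have "?s (lo i (Suc j)) $ i \<le> 0" "0 \<le> ?s (hi i (Suc j)) $ i"
        using hi(2)[of "Suc j" 0 i] lo(2)[of "Suc j" 0 i] zero_digit[of "Suc j"] by (auto simp: zero)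
      ultimately show "\<bar>?s b $ i\<bar> \<le> ?s (hi i (Suc j)) $ i - ?s (lo i (Suc j)) $ i" by linarith
    qed
    finally show "norm (?s b) \<le> M j" .
  qed
qed

text \<open>The tail set is a continuous image of a product of finite sets, which is compact by
  Tychonoff; continuity of the series follows from the Weierstrass M-test. This makes the cells
  Borel sets.\<close>

lemma compact_tail_set: "compact (tail_set R B n)"
proof -
  define K where "K = (\<Pi>\<^sub>E i\<in>UNIV. B (n + 1 + i))"
  define \<psi> where "\<psi> \<gamma> = (\<Sum>i. scaled_digit R (n + 1 + i) (\<gamma> i))" for \<gamma>
  have "compactin (product_topology (\<lambda>_. euclidean) UNIV) K"
    unfolding K_def compactin_PiE using finite_digits by (auto intro: finite_imp_compact)
  then have "compact K" by (simp add: euclidean_product_topology)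
  obtain M where M: "summable M" "\<And>i b. b \<in> B (Suc i) \<Longrightarrow> norm (scaled_digit R (Suc i) b) \<le> M i"
    using digit_bound by blast
  have "uniform_limit K (\<lambda>m \<gamma>. \<Sum>i<m. scaled_digit R (n + 1 + i) (\<gamma> i)) \<psi> sequentially"
    unfolding \<psi>_def[abs_def]
  proof (rule Weierstrass_m_test)
    \<comment> \<open>Entry \<open>i\<close> of \<open>\<gamma>\<close> is the digit at level
      \<open>n + 1 + i = Suc (i + n)\<close>, hence the shifted bound.\<close>
    show "norm (scaled_digit R (n + 1 + i) (\<gamma> i)) \<le> M (i + n)" if "\<gamma> \<in> K" for i \<gamma>
      using M(2)[of "\<gamma> i" "i + n"] that by (auto simp: K_def add.commute)
    show "summable (\<lambda>i. M (i + n))" using M(1) by (rule summable_ignore_initial_segment)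
  qed
  then have "continuous_on K \<psi>"
  proof (rule uniform_limit_theorem[rotated])
    have "continuous_on K (\<lambda>\<gamma>. scaled_digit R k (\<gamma> i))" for k i
      by (rule continuous_on_compose2[OF continuous_on_scaled_digit[of UNIV]])
        (auto intro!: continuous_on_subset[OF continuous_on_product_coordinates])
    then show "\<forall>\<^sub>F m in sequentially. continuous_on K (\<lambda>\<gamma>. \<Sum>i<m. scaled_digit R (n + 1 + i) (\<gamma> i))"
      by (intro always_eventually allI continuous_on_sum)
  qed simp
  then have "compact (\<psi> ` K)" using \<open>compact K\<close> by (rule compact_continuous_image)
  also have "\<psi> ` K = tail_set R B n"
  proof (intro set_eqI iffI)
    fix x assume "x \<in> \<psi> ` K"
    then obtain \<gamma> where \<gamma>: "\<gamma> \<in> K" "x = \<psi> \<gamma>" by blast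
    have "\<gamma> (k - (n + 1)) \<in> B k" if "k > n" for k
      using \<gamma>(1) that PiE_mem[of \<gamma> UNIV "\<lambda>i. B (n + 1 + i)" "k - (n + 1)"] by (simp add: K_def)
    then show "x \<in> tail_set R B n"
      unfolding tail_set_def using \<gamma>(2)
      by (intro CollectI exI[of _ "\<lambda>k. \<gamma> (k - (n + 1))"]) (simp add: \<psi>_def)
  next
    fix x assume "x \<in> tail_set R B n"
    then obtain b where b: "\<forall>k>n. b k \<in> B k" "x = (\<Sum>i. scaled_digit R (n + 1 + i) (b (n + 1 + i)))"
      by (auto simp: tail_set_def)
    then show "x \<in> \<psi> ` K"
      by (intro image_eqI[of _ _ "\<lambda>i. b (n + 1 + i)"]) (auto simp: \<psi>_def K_def)
  qed
  finally show ?thesis .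
qed


section \<open>The infinite convolution as the law of a random series\<close>

text \<open>\<open>B 0\<close> is arbitrary, but every \<open>pmf\<close> yields a probability
  measure, so the product can run over all natural numbers. All sets of digits are
  measurable.\<close>

definition digit_measure :: "nat \<Rightarrow> (int ^ 'n) measure" where
  "digit_measure k = measure_pmf (pmf_of_set (B k))"

definition digit_space :: "(nat \<Rightarrow> int ^ 'n) measure" where
  "digit_space = PiM UNIV digit_measure"

sublocale digits: prob_space digit_space
  unfolding digit_space_def digit_measure_def by (intro prob_space_PiM measure_pmf.prob_space_axioms)

lemma sets_digit_measure [simp]: "sets (digit_measure k) = UNIV" "space (digit_measure k) = UNIV"
  by (simp_all add: digit_measure_def)

lemma space_digit_space [simp]: "space digit_space = UNIV"
  by (simp add: digit_space_def space_PiM)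

lemma measurable_digit [measurable (raw)]:
  "k \<in> I \<Longrightarrow> f \<in> UNIV \<rightarrow> space N \<Longrightarrow> (\<lambda>\<omega>. f (\<omega> k)) \<in> measurable (PiM I digit_measure) N"
  by (rule measurable_compose[OF measurable_component_singleton])
    (auto simp: digit_measure_def)

text \<open>Stated for any index set \<open>I\<close> that contains the digits involved:
  independence of blocks requires measurability with respect to those digits alone.\<close>

lemma measurable_digit_series:
  assumes "{n<..} \<subseteq> I"
  shows "tail_series R n \<in> borel_measurable (PiM I digit_measure)"
  unfolding tail_series_def[abs_def]
  using assms by (intro borel_measurable_suminf measurable_digit) auto

lemma measurable_partial_series:
  assumes "{1..n} \<subseteq> I"
  shows "partial_series R n \<in> borel_measurable (PiM I digit_measure)"
  unfolding partial_series_def[abs_def]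
  using assms by (intro borel_measurable_sum measurable_digit) auto

lemma AE_digits: "AE \<omega> in digit_space. \<forall>k\<ge>1. \<omega> k \<in> B k"
proof -
  have "AE \<omega> in digit_space. k \<ge> 1 \<longrightarrow> \<omega> k \<in> B k" for k
  proof (cases "k \<ge> 1")
    case True
    have "AE x in digit_measure k. x \<in> B k"
      using finite_digits[OF True] zero_digit[OF True]
        set_pmf_of_set[of "B k"] unfolding digit_measure_def AE_measure_pmf_iff by blast
    then have "AE \<omega> in digit_space. \<omega> k \<in> B k"
      unfolding digit_space_def
      by (intro AE_PiM_component) (auto simp: digit_measure_def measure_pmf.prob_space_axioms)
    then show ?thesis by eventually_elim simp
  qed simp
  then show ?thesis by (simp add: AE_all_countable)
qed

lemma indep_digits: "digits.indep_vars digit_measure (\<lambda>k \<omega>. \<omega> k) UNIV"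
proof -
  have prob: "prob_space (digit_measure k)" for k
    by (simp add: digit_measure_def measure_pmf.prob_space_axioms)
  have "distr digit_space (digit_measure k) (\<lambda>\<omega>. \<omega> k) = digit_measure k" for k
    unfolding digit_space_def by (intro distr_PiM_component prob) auto
  moreover have "distr digit_space (PiM UNIV digit_measure) (\<lambda>x. x) = digit_space"
    unfolding digit_space_def by (rule distr_id)
  ultimately show ?thesis
    by (subst digits.indep_vars_iff_distr_eq_PiM)
      (auto simp: digit_space_def restrict_UNIV
        intro!: measurable_component_singleton)
qed

text \<open>The two \<open>restrict\<close> equations express that \<open>f\<close> and
  \<open>g\<close> depend only on the digits in \<open>I\<close> and in \<open>J\<close>; disjoint
  blocks of independent digits are independent.\<close>

lemma indep_blocks:
  assumes "I \<inter> J = {}"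
    and "f \<in> measurable (PiM I digit_measure) N" "g \<in> measurable (PiM J digit_measure) N'"
    and "\<And>\<omega>. f (restrict \<omega> I) = f \<omega>" "\<And>\<omega>. g (restrict \<omega> J) = g \<omega>"
  shows "digits.indep_var N f N' g"
proof -
  have "digits.indep_var (PiM I digit_measure) (\<lambda>\<omega>. restrict \<omega> I) (PiM J digit_measure) (\<lambda>\<omega>. restrict \<omega> J)"
    using digits.indep_var_restrict[OF indep_digits assms(1)] by simp
  from digits.indep_var_compose[OF this assms(2,3)] show ?thesis
    by (simp add: comp_def assms(4,5))
qed

lemma inj_scaled_digit: "inj (scaled_digit R k)"
proof (rule injI)
  fix v w assume "scaled_digit R k v = scaled_digit R k w"
  then have "real_vec v = real_vec w"
    unfolding scaled_digit_def using inv_app_cancel(2)[OF invertible_mat_prod[of k]] by metis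
  then show "v = w" by simp
qed

text \<open>Scaling is injective, so it carries the uniform distribution on the digits to the
  uniform distribution on their images.\<close>

lemma distr_scaled_digit:
  assumes "k \<ge> 1"
  shows "distr digit_space borel (\<lambda>\<omega>. scaled_digit R k (\<omega> k)) = unif_dirac (scaled_digit R k ` B k)"
proof -
  have k: "distr digit_space (digit_measure k) (\<lambda>\<omega>. \<omega> k) = digit_measure k"
    unfolding digit_space_def
    by (intro distr_PiM_component) (auto simp: digit_measure_def measure_pmf.prob_space_axioms)
  have "pmf_of_set (scaled_digit R k ` B k) = map_pmf (scaled_digit R k) (pmf_of_set (B k))"
    using finite_digits[OF assms] zero_digit[OF assms] inj_scaled_digit
    by (subst map_pmf_of_set_inj) (auto intro: inj_on_subset)
  then have "unif_dirac (scaled_digit R k ` B k) = distr (digit_measure k) borel (scaled_digit R k)"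
    by (simp add: unif_dirac_def digit_measure_def map_pmf_rep_eq distr_distr comp_def)
  also have "\<dots> = distr digit_space borel (\<lambda>\<omega>. scaled_digit R k (\<omega> k))"
    by (subst k[symmetric], subst distr_distr)
      (auto simp: comp_def digit_space_def digit_measure_def intro!: measurable_component_singleton)
  finally show ?thesis by simp
qed

text \<open>The new digit is independent of the earlier ones, so adding its term convolves the
  laws.\<close>

lemma distr_partial_series: "distr digit_space borel (partial_series R n) = partial_conv R B n"
proof (induction n)
  case 0
  show ?case
    by (simp add: partial_series_def[abs_def] digits.distr_const)
next
  case (Suc n)
  let ?s = "\<lambda>\<omega>. scaled_digit R (Suc n) (\<omega> (Suc n))"
  have "digits.indep_var borel (partial_series R n) borel ?s"
    by (rule indep_blocks[of "{1..n}" "{Suc n}"])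
      (auto intro!: measurable_partial_series measurable_digit simp: partial_series_def)
  moreover have "partial_series R n \<in> borel_measurable digit_space" "?s \<in> borel_measurable digit_space"
    by (auto simp: digit_space_def intro!: measurable_partial_series measurable_digit)
  ultimately have "distr digit_space borel (\<lambda>\<omega>. partial_series R n \<omega> + ?s \<omega>)
      = convolution (distr digit_space borel (partial_series R n)) (distr digit_space borel ?s)"
    by (rule digits.sum_indep_random_variable)
  moreover have "partial_series R (Suc n) = (\<lambda>\<omega>. partial_series R n \<omega> + ?s \<omega>)"
    by (simp add: partial_series_def fun_eq_iff)
  ultimately show ?case by (simp add: Suc distr_scaled_digit)
qed

lemma partial_series_eq: "partial_series R n \<omega> = (\<Sum>i<n. scaled_digit R (0 + 1 + i) (\<omega> (0 + 1 + i)))"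
  by (simp add: partial_series_def sum.atLeast1_atMost_eq)

lemma summable_digits:
  assumes "\<And>k. k > n \<Longrightarrow> \<omega> k \<in> B k"
  shows "summable (\<lambda>i. scaled_digit R (n + 1 + i) (\<omega> (n + 1 + i)))"
  using converge assms unfolding digit_series_converge_def by blast

lemma partial_plus_tail:
  assumes "\<And>k. k \<ge> 1 \<Longrightarrow> \<omega> k \<in> B k"
  shows "tail_series R 0 \<omega> = partial_series R n \<omega> + tail_series R n \<omega>"
proof -
  have "summable (\<lambda>i. scaled_digit R (0 + 1 + i) (\<omega> (0 + 1 + i)))"
    using assms by (intro summable_digits) auto
  from suminf_split_initial_segment[OF this, of n] show ?thesis
    by (simp add: tail_series_def partial_series_eq add.commute)
qed

lemma partial_series_tendsto:
  assumes "\<And>k. k \<ge> 1 \<Longrightarrow> \<omega> k \<in> B k"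
  shows "(\<lambda>n. partial_series R n \<omega>) \<longlonglongrightarrow> tail_series R 0 \<omega>"
proof -
  have "summable (\<lambda>i. scaled_digit R (0 + 1 + i) (\<omega> (0 + 1 + i)))"
    using assms by (intro summable_digits) auto
  from summable_LIMSEQ[OF this] show ?thesis
    by (simp only: tail_series_def partial_series_eq)
qed

text \<open>The partial sums converge almost surely, so by dominated convergence their laws converge
  weakly to the law of the full series; the weak limit is unique.\<close>

lemma distr_tail_series:
  assumes "infinite_convolution R B \<mu>"
  shows "\<mu> = distr digit_space borel (tail_series R 0)"
proof (rule measure_eqI_continuous_bounded)
  have meas: "tail_series R 0 \<in> borel_measurable digit_space" "\<And>n. partial_series R n \<in> borel_measurable digit_space"
    by (auto simp: digit_space_def intro!: measurable_digit_series measurable_partial_series)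
  show "prob_space \<mu>" "sets \<mu> = sets borel" using assms by (auto simp: infinite_convolution_def)
  show "prob_space (distr digit_space borel (tail_series R 0))"
    using meas(1) by (rule digits.prob_space_distr)
  fix f :: "real^'n \<Rightarrow> real" assume f: "continuous_on UNIV f" "bounded (range f)"
  then have fm [measurable]: "f \<in> borel_measurable borel" by (intro borel_measurable_continuous_onI)
  from f(2) obtain C where C: "\<And>x. \<bar>f x\<bar> \<le> C" by (auto simp: bounded_iff)
  have "(\<lambda>n. integral\<^sup>L (partial_conv R B n) f) \<longlonglongrightarrow> integral\<^sup>L \<mu> f"
    using assms f by (auto simp: infinite_convolution_def weak_limit_def)
  then have "(\<lambda>n. \<integral>\<omega>. f (partial_series R n \<omega>) \<partial>digit_space) \<longlonglongrightarrow> integral\<^sup>L \<mu> f"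
    unfolding distr_partial_series[symmetric] using meas by (simp add: integral_distr)
  moreover have "(\<lambda>n. \<integral>\<omega>. f (partial_series R n \<omega>) \<partial>digit_space) \<longlonglongrightarrow>
      (\<integral>\<omega>. f (tail_series R 0 \<omega>) \<partial>digit_space)"
  proof (rule integral_dominated_convergence[where w="\<lambda>_. C"])
    show "AE \<omega> in digit_space. (\<lambda>n. f (partial_series R n \<omega>)) \<longlonglongrightarrow> f (tail_series R 0 \<omega>)"
      using AE_digits
    proof eventually_elim
      case (elim \<omega>)
      then show ?case
        by (intro continuous_on_tendsto_compose[OF f(1) partial_series_tendsto]) auto
    qed
  qed (use meas C in \<open>auto intro: measurable_compose[OF _ fm]\<close>)
  ultimately have "integral\<^sup>L \<mu> f = (\<integral>\<omega>. f (tail_series R 0 \<omega>) \<partial>digit_space)"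
    by (rule LIMSEQ_unique)
  then show "integral\<^sup>L \<mu> f = integral\<^sup>L (distr digit_space borel (tail_series R 0)) f"
    using meas by (simp add: integral_distr)
qed simp

section \<open>Cylinders and their independence from the tail\<close>

definition cylinder :: "nat \<Rightarrow> (nat \<Rightarrow> int ^ 'n) \<Rightarrow> (nat \<Rightarrow> int ^ 'n) set" where
  "cylinder n \<beta> = {\<omega>. \<forall>k\<in>{1..n}. \<omega> k = \<beta> k}"

lemma measure_cylinder:
  assumes "\<And>k. k \<in> {1..n} \<Longrightarrow> \<beta> k \<in> B k"
  shows "measure digit_space (cylinder n \<beta>) = (\<Prod>k=1..n. 1 / card (B k))"
proof -
  have prob: "prob_space (digit_measure k)" for k
    by (simp add: digit_measure_def measure_pmf.prob_space_axioms)
  then interpret P: product_prob_space digit_measure UNIV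
    by (simp add: product_prob_space_def product_prob_space_axioms_def product_sigma_finite_def
        prob_space_imp_sigma_finite)
  have "cylinder n \<beta> = prod_emb UNIV digit_measure {1..n} (\<Pi>\<^sub>E k\<in>{1..n}. {\<beta> k})"
    by (auto simp: cylinder_def prod_emb_def PiE_iff space_PiM)
  then have "measure digit_space (cylinder n \<beta>) = (\<Prod>k=1..n. measure (digit_measure k) {\<beta> k})"
    by (simp add: digit_space_def P.measure_PiM_emb)
  also have "\<dots> = (\<Prod>k=1..n. 1 / card (B k))"
  proof (intro prod.cong refl)
    fix k assume k: "k \<in> {1..n}"
    then have "finite (B k)" "B k \<noteq> {}" using finite_digits[of k] zero_digit[of k] by auto
    then show "measure (digit_measure k) {\<beta> k} = 1 / card (B k)"
      using assms[OF k] by (simp add: digit_measure_def measure_pmf_single)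
  qed
  finally show ?thesis .
qed

text \<open>The value type is left general: the real indicator shows that cylinders are measurable
  sets, the complex one enters the independence argument.\<close>

lemma measurable_indicator_cylinder:
  assumes "{1..n} \<subseteq> I"
  shows "(indicator (cylinder n \<beta>) :: _ \<Rightarrow> 'c::{second_countable_topology, real_normed_field}) \<in> borel_measurable (PiM I digit_measure)"
proof -
  have "(indicator (cylinder n \<beta>) :: _ \<Rightarrow> 'c) = (\<lambda>\<omega>. \<Prod>k=1..n. of_bool (\<omega> k = \<beta> k))"
    by (auto simp: cylinder_def indicator_def fun_eq_iff)
  also have "\<dots> \<in> borel_measurable (PiM I digit_measure)"
    using assms by (intro borel_measurable_prod measurable_digit) auto
  finally show ?thesis .
qed

lemma sets_cylinder [measurable]: "cylinder n \<beta> \<in> sets digit_space"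
  using measurable_indicator_cylinder[of n UNIV \<beta>, where 'c=real]
  by (simp add: digit_space_def borel_measurable_indicator_iff space_PiM)

text \<open>The cylinder depends on the first \<open>n\<close> digits and the tail on the later
  ones, so the integral of the product factors.\<close>

lemma integral_cylinder_exponential:
  "(\<integral>\<omega>. indicator (cylinder n \<beta>) \<omega> * exponential l (tail_series R n \<omega>) \<partial>digit_space) =
     of_real (measure digit_space (cylinder n \<beta>)) *
     (\<integral>\<omega>. exponential l (tail_series R n \<omega>) \<partial>digit_space)"
proof (subst digits.indep_var_lebesgue_integral)
  have meas: "(\<lambda>\<omega>. exponential l (tail_series R n \<omega>)) \<in> borel_measurable (PiM I digit_measure)"
    if "{n<..} \<subseteq> I" for I
    by (rule measurable_compose[OF measurable_digit_series[OF that]]) simp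
  show "digits.indep_var borel (indicator (cylinder n \<beta>)) borel
      (\<lambda>\<omega>. exponential l (tail_series R n \<omega>))"
    by (rule indep_blocks[of "{1..n}" "{n<..}"])
      (auto intro!: measurable_indicator_cylinder meas
        simp: tail_series_def cylinder_def indicator_def)
  show "integrable digit_space (\<lambda>\<omega>. exponential l (tail_series R n \<omega>))"
    using meas[of UNIV] by (intro digits.integrable_const_bound[where B=1]) (auto simp: digit_space_def)
  show "integrable digit_space (indicator (cylinder n \<beta>) :: _ \<Rightarrow> complex)"
    by (intro digits.integrable_const_bound[where B=1]) (auto simp: indicator_def)
  have "(\<integral>\<omega>. indicator (cylinder n \<beta>) \<omega> *\<^sub>R (1 :: complex) \<partial>digit_space) =
      of_real (measure digit_space (cylinder n \<beta>))"
    by (subst has_bochner_integral_integral_eq[OF has_bochner_integral_indicator])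
      (auto simp: scaleR_conv_of_real digits.emeasure_eq_measure)
  moreover have "(\<lambda>\<omega>. indicator (cylinder n \<beta>) \<omega> *\<^sub>R (1 :: complex)) = indicator (cylinder n \<beta>)"
    by (auto simp: indicator_def)
  ultimately show "(\<integral>\<omega>. indicator (cylinder n \<beta>) \<omega> \<partial>digit_space) *
        (\<integral>\<omega>. exponential l (tail_series R n \<omega>) \<partial>digit_space) =
      complex_of_real (measure digit_space (cylinder n \<beta>)) *
        (\<integral>\<omega>. exponential l (tail_series R n \<omega>) \<partial>digit_space)"
    by simp
qed

end

section \<open>A function orthogonal to all exponentials\<close>

lemma exponential_zero [simp]: "exponential 0 x = 1"
  by (simp add: exponential_def)

lemma exponential_sum: "exponential (\<Sum>k\<in>A. v k) x = (\<Prod>k\<in>A. exponential (v k) x)"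
  by (induction A rule: infinite_finite_induct) (simp_all add: exponential_add_left)

lemma borel_measurable_cnj [measurable (raw)]:
  "f \<in> borel_measurable M \<Longrightarrow> (\<lambda>x. cnj (f x)) \<in> borel_measurable M"
  by (rule measurable_compose[OF _ borel_measurable_continuous_onI]) (auto intro: continuous_intros)

text \<open>Pythagoras: \<open>f\<close> is orthogonal to every \<open>g\<close> in the span, so the
  squared distance from \<open>f\<close> to \<open>g\<close> is the sum of their squared norms. No
  such \<open>g\<close> comes closer to \<open>f\<close> than the norm of \<open>f\<close>, which is
  the \<open>\<epsilon>\<close> chosen below. Boundedness supplies integrability.\<close>

lemma (in prob_space) not_complete_in_L2I:
  assumes e: "\<And>i. i \<in> I \<Longrightarrow> e i \<in> borel_measurable M" "\<And>i x. i \<in> I \<Longrightarrow> cmod (e i x) \<le> 1"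
    and f: "f \<in> borel_measurable M" "\<And>x. cmod (f x) \<le> C"
    and orth: "\<And>i. i \<in> I \<Longrightarrow> (\<integral>x. cnj (f x) * e i x \<partial>M) = 0"
    and pos: "(\<integral>x. (cmod (f x))\<^sup>2 \<partial>M) > 0"
  shows "\<not> complete_in_L2 M I e"
proof
  assume complete: "complete_in_L2 M I e"
  have f2: "integrable M (\<lambda>x. (cmod (f x))\<^sup>2)"
  proof (rule integrable_const_bound[where B="C\<^sup>2"])
    show "AE x in M. norm ((cmod (f x))\<^sup>2) \<le> C\<^sup>2" using f(2) by (simp add: power_mono)
  qed (use f(1) in measurable)
  define \<epsilon> where "\<epsilon> = sqrt (\<integral>x. (cmod (f x))\<^sup>2 \<partial>M)"
  have \<epsilon>: "\<epsilon> > 0" "\<epsilon>\<^sup>2 = (\<integral>x. (cmod (f x))\<^sup>2 \<partial>M)" using pos by (auto simp: \<epsilon>_def)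
  have "in_L2 M f" using f(1) f2 by (simp add: in_L2_def)
  from complete[unfolded complete_in_L2_def, rule_format, OF this \<epsilon>(1)] obtain F c where F: "finite F" "F \<subseteq> I"
    and less: "(\<integral>\<^sup>+x. ennreal ((cmod (f x - (\<Sum>i\<in>F. c i * e i x)))\<^sup>2) \<partial>M) < ennreal (\<epsilon>\<^sup>2)"
    by auto
  define g where "g x = (\<Sum>i\<in>F. c i * e i x)" for x
  define G where "G = (\<Sum>i\<in>F. cmod (c i))"
  have gm [measurable]: "g \<in> borel_measurable M"
    unfolding g_def[abs_def] using e(1) F by (intro borel_measurable_sum borel_measurable_times) auto
  have gb: "cmod (g x) \<le> G" for x unfolding g_def G_def
    using e(2) F by (intro sum_norm_le) (auto simp: norm_mult intro!: mult_left_le)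
  note [measurable] = f(1)
  have g2: "integrable M (\<lambda>x. (cmod (g x))\<^sup>2)"
  proof (rule integrable_const_bound[where B="G\<^sup>2"])
    show "AE x in M. norm ((cmod (g x))\<^sup>2) \<le> G\<^sup>2" using gb by (simp add: power_mono)
  qed measurable
  have "cmod (cnj (f x) * e i x) \<le> C" if "i \<in> F" for i x
    using mult_left_le[of "cmod (e i x)" "cmod (f x)"] e(2)[of i x] f(2)[of x] F(2) that
    by (auto simp: norm_mult)
  then have inte: "integrable M (\<lambda>x. cnj (f x) * e i x)" if "i \<in> F" for i
    using that F f(1) e(1) by (intro integrable_const_bound[where B="C"] borel_measurable_times
        borel_measurable_cnj) auto
  have fg: "(\<lambda>x. cnj (f x) * g x) = (\<lambda>x. \<Sum>i\<in>F. c i * (cnj (f x) * e i x))"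
    by (simp add: g_def sum_distrib_left mult_ac)
  have ifg: "integrable M (\<lambda>x. cnj (f x) * g x)"
    unfolding fg using inte by (intro Bochner_Integration.integrable_sum integrable_mult_right) auto
  have "(\<integral>x. cnj (f x) * g x \<partial>M) = 0"
    unfolding fg using inte F orth
    by (subst Bochner_Integration.integral_sum) (auto intro!: sum.neutral)
  moreover define h where "h x = Re (cnj (f x) * g x)" for x
  ultimately have h: "integrable M h" "(\<integral>x. h x \<partial>M) = 0"
    using integrable_Re[OF ifg] integral_Re[OF ifg] by (simp_all only: h_def[abs_def] zero_complex.simps)
  have eq: "(cmod (f x - g x))\<^sup>2 = (cmod (f x))\<^sup>2 + (cmod (g x))\<^sup>2 - 2 * h x" for x
    unfolding cmod_power2 h_def by (simp add: power2_eq_square algebra_simps)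
  have "(\<integral>x. (cmod (f x - g x))\<^sup>2 \<partial>M) = \<epsilon>\<^sup>2 + (\<integral>x. (cmod (g x))\<^sup>2 \<partial>M)"
    unfolding eq using f2 g2 h \<epsilon>(2) by simp
  then have "\<epsilon>\<^sup>2 \<le> (\<integral>x. (cmod (f x - g x))\<^sup>2 \<partial>M)" by simp
  moreover have "integrable M (\<lambda>x. (cmod (f x - g x))\<^sup>2)"
    unfolding eq using f2 g2 h by simp
  then have "(\<integral>\<^sup>+x. ennreal ((cmod (f x - g x))\<^sup>2) \<partial>M) = ennreal (\<integral>x. (cmod (f x - g x))\<^sup>2 \<partial>M)"
    by (rule nn_integral_eq_integral) simp
  then have "(\<integral>x. (cmod (f x - g x))\<^sup>2 \<partial>M) < \<epsilon>\<^sup>2"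
    using less \<epsilon>(1) by (simp add: g_def ennreal_less_iff)
  ultimately show False by simp
qed

section \<open>Frequencies and cells at a finite level\<close>

context digit_system
begin

text \<open>A frequency of level \<open>k\<close> carries \<open>k - 1\<close> transposed matrices.
  For \<open>k > n\<close> these include the transpose of \<open>mat_prod R n\<close>, which maps
  the partial series to an integer vector, so periodicity applies.\<close>

lemma exponential_partial_series_tail:
  assumes "k > n"
  shows "exponential (transpose_prod R (k - 1) *v l) (partial_series R n \<beta>) = 1"
proof -
  have "n \<le> k - 1" using assms by simp
  from mat_prod_factor[OF this, of R] obtain Q where Q: "mat_prod R (k - 1) = Q ** mat_prod R n"
    by blast
  have "transpose_prod R (k - 1) *v l = transpose (mat_prod R n) *v (transpose Q *v l)"
    unfolding transpose_prod_eq Q matrix_transpose_mul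
    by (simp only: matrix_vector_mul_assoc)
  then show ?thesis
    using exponential_periodic[OF real_mat_partial_series] by simp
qed

lemma freq_level_reduce:
  assumes "l \<in> freq_level R L m" "\<And>k. k \<ge> 1 \<Longrightarrow> 0 \<in> L k"
  shows "\<exists>l'\<in>freq_level R L n. \<forall>\<beta>.
    exponential l (partial_series R n \<beta>) = exponential l' (partial_series R n \<beta>)"
proof -
  obtain w where w: "l = (\<Sum>k=1..m. transpose_prod R (k - 1) *v w k)" "\<forall>k\<in>{1..m}. w k \<in> L k"
    using assms(1) by (auto simp: freq_level_def)
  \<comment> \<open>Cut off above level \<open>n\<close>, and padded with the frequency 0 when
    \<open>m < n\<close>.\<close>
  define w' where "w' k = (if k \<le> m then w k else 0)" for k
  define l' where "l' = (\<Sum>k=1..n. transpose_prod R (k - 1) *v w' k)"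
  have "l' \<in> freq_level R L n"
    unfolding freq_level_def l'_def using w(2) assms(2) by (auto simp: w'_def)
  moreover have "exponential l (partial_series R n \<beta>) = exponential l' (partial_series R n \<beta>)" for \<beta>
  proof -
    let ?e = "\<lambda>w k. exponential (transpose_prod R (k - 1) *v w k) (partial_series R n \<beta>)"
    have "exponential l (partial_series R n \<beta>) = (\<Prod>k=1..m. ?e w k)"
      by (simp add: w(1) exponential_sum)
    also have "\<dots> = (\<Prod>k=1..min m n. ?e w k)"
      by (intro prod.mono_neutral_right) (auto simp: exponential_partial_series_tail[unfolded One_nat_def])
    also have "\<dots> = (\<Prod>k=1..min m n. ?e w' k)"
      by (intro prod.cong) (auto simp: w'_def)
    also have "\<dots> = (\<Prod>k=1..n. ?e w' k)"
      by (intro prod.mono_neutral_left) (auto simp: w'_def)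
    finally show ?thesis by (simp add: l'_def exponential_sum)
  qed
  ultimately show ?thesis by blast
qed

text \<open>Only an upper bound, since different words of frequencies may have the same sum.\<close>

lemma freq_level_card:
  assumes "\<And>k. k \<ge> 1 \<Longrightarrow> finite (L k)"
  shows "finite (freq_level R L n)" "card (freq_level R L n) \<le> (\<Prod>k=1..n. card (L k))"
proof -
  have sub: "freq_level R L n \<subseteq> (\<lambda>w. \<Sum>k=1..n. transpose_prod R (k - 1) *v w k) ` (\<Pi>\<^sub>E k\<in>{1..n}. L k)"
  proof
    fix l assume "l \<in> freq_level R L n"
    then obtain w where "l = (\<Sum>k=1..n. transpose_prod R (k - 1) *v w k)" "\<forall>k\<in>{1..n}. w k \<in> L k"
      by (auto simp: freq_level_def)
    then show "l \<in> (\<lambda>w. \<Sum>k=1..n. transpose_prod R (k - 1) *v w k) ` (\<Pi>\<^sub>E k\<in>{1..n}. L k)"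
      by (intro image_eqI[of _ _ "restrict w {1..n}"]) auto
  qed
  have fin: "finite (\<Pi>\<^sub>E k\<in>{1..n}. L k)" using assms by (intro finite_PiE) auto
  show "finite (freq_level R L n)" using sub fin by (rule finite_surj[rotated])
  show "card (freq_level R L n) \<le> (\<Prod>k=1..n. card (L k))"
    using surj_card_le[OF fin sub] by (simp add: card_PiE)
qed

text \<open>A sequence of digits always lands in the cell of its own first \<open>n\<close> digits.
  Distinct cosets make different words give different points of \<open>digit_level\<close>, so
  no-overlap excludes a second cell outside a null set.\<close>

lemma cells_disjoint_AE:
  assumes "infinite_convolution R B \<mu>" "no_overlap R B \<mu>"
    and distinct: "\<And>j. j \<ge> 1 \<Longrightarrow> distinct_cosets (R j) (B j)" and "n \<ge> 1"
  shows "AE \<omega> in digit_space. \<forall>\<beta>\<in>\<Pi>\<^sub>E k\<in>{1..n}. B k.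
    tail_series R 0 \<omega> \<in> (+) (partial_series R n \<beta>) ` tail_set R B n \<longleftrightarrow> \<omega> \<in> cylinder n \<beta>"
proof -
  let ?I = "\<Pi>\<^sub>E k\<in>{1..n}. B k"
  let ?cell = "\<lambda>\<beta>. (+) (partial_series R n \<beta>) ` tail_set R B n"
  have fin: "finite ?I" using finite_digits by (intro finite_PiE) auto
  have null: "?cell \<beta> \<inter> ?cell \<gamma> \<in> null_sets \<mu>" if "\<beta> \<in> ?I" "\<gamma> \<in> ?I" "\<beta> \<noteq> \<gamma>" for \<beta> \<gamma>
  proof -
    \<comment> \<open>\<open>no_overlap\<close> names cells by the rescaled points of
      \<open>digit_level\<close>; \<open>inv_app\<close> turns them back into partial
      series.\<close>
    let ?b = "\<lambda>\<beta>. real_mat (mat_prod R n) *v partial_series R n \<beta>"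
    have "?b \<beta> \<in> digit_level R B n" if "\<beta> \<in> ?I" for \<beta>
      unfolding digit_level_def using that by (auto simp: partial_series_def)
    moreover have "?b \<beta> \<noteq> ?b \<gamma>"
    proof
      assume "?b \<beta> = ?b \<gamma>"
      then have eq: "digit_expansion R n \<beta> = digit_expansion R n \<gamma>"
        by (simp add: real_mat_partial_series)
      have "\<beta> k = \<gamma> k" if "k \<in> {1..n}" for k
        using digit_expansion_inj[OF distinct _ _ eq that] PiE_mem[OF \<open>\<beta> \<in> ?I\<close>] PiE_mem[OF \<open>\<gamma> \<in> ?I\<close>]
        by blast
      then show False using that PiE_ext by blast
    qed
    ultimately have "(+) (inv_app (mat_prod R n) (?b \<beta>)) ` tail_set R B n \<inter>
        (+) (inv_app (mat_prod R n) (?b \<gamma>)) ` tail_set R B n \<in> null_sets \<mu>"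
      using assms(2) \<open>n \<ge> 1\<close> that unfolding no_overlap_def by blast
    then show ?thesis by (simp add: inv_app_cancel(1)[OF invertible_mat_prod])
  qed
  have "AE x in \<mu>. \<beta> \<noteq> \<gamma> \<longrightarrow> x \<notin> ?cell \<beta> \<inter> ?cell \<gamma>" if "\<beta> \<in> ?I" "\<gamma> \<in> ?I" for \<beta> \<gamma>
    using AE_not_in[OF null[OF that]] by (cases "\<beta> = \<gamma>") auto
  then have "AE x in \<mu>. \<forall>\<beta>\<in>?I. \<forall>\<gamma>\<in>?I. \<beta> \<noteq> \<gamma> \<longrightarrow> x \<notin> ?cell \<beta> \<inter> ?cell \<gamma>"
    using fin by (intro AE_finite_allI)
  then have "AE \<omega> in digit_space. \<forall>\<beta>\<in>?I. \<forall>\<gamma>\<in>?I. \<beta> \<noteq> \<gamma> \<longrightarrow>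
      tail_series R 0 \<omega> \<notin> ?cell \<beta> \<inter> ?cell \<gamma>"
    unfolding distr_tail_series[OF assms(1)]
    by (rule AE_distrD[rotated]) (auto simp: digit_space_def intro!: measurable_digit_series)
  with AE_digits show ?thesis
  proof eventually_elim
    case (elim \<omega>)
    let ?\<gamma> = "restrict \<omega> {1..n}"
    have \<gamma>: "?\<gamma> \<in> ?I" using elim(1) by auto
    have "tail_series R 0 \<omega> = partial_series R n ?\<gamma> + tail_series R n \<omega>"
      using partial_plus_tail[of \<omega> n] elim(1) by (simp add: partial_series_def)
    moreover have "tail_series R n \<omega> \<in> tail_set R B n"
      using elim(1) by (auto simp: tail_set_def tail_series_def)
    ultimately have "tail_series R 0 \<omega> \<in> ?cell ?\<gamma>" by simp
    moreover have "\<omega> \<in> cylinder n \<beta> \<longleftrightarrow> ?\<gamma> = \<beta>" if "\<beta> \<in> ?I" for \<beta>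
      using that by (auto simp: cylinder_def fun_eq_iff PiE_def extensional_def)
    ultimately show ?case using elim(2) \<gamma> by blast
  qed
qed


lemma freq_set_not_complete:
  assumes conv: "infinite_convolution R B \<mu>" and "no_overlap R B \<mu>"
    and distinct: "\<And>j. j \<ge> 1 \<Longrightarrow> distinct_cosets (R j) (B j)" and "n \<ge> 1"
    and L: "\<And>j. j \<ge> 1 \<Longrightarrow> finite (L j)" "\<And>j. j \<ge> 1 \<Longrightarrow> 0 \<in> L j"
    and card: "(\<Prod>k=1..n. card (L k)) < (\<Prod>k=1..n. card (B k))"
  shows "\<not> complete_in_L2 \<mu> (freq_set R L) exponential"
proof -
  let ?I = "\<Pi>\<^sub>E k\<in>{1..n}. B k"
  let ?cell = "\<lambda>\<beta>. (+) (partial_series R n \<beta>) ` tail_set R B n"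
  define X where "X = tail_series R 0"
  define p where "p = (\<Prod>k=1..n. 1 / real (card (B k)))"
  have \<mu>: "\<mu> = distr digit_space borel X" unfolding X_def using conv by (rule distr_tail_series)
  have X [measurable]: "X \<in> borel_measurable digit_space"
    by (auto simp: digit_space_def X_def intro!: measurable_digit_series)
  interpret \<mu>: prob_space \<mu> using conv by (simp add: infinite_convolution_def)
  have [measurable_cong]: "sets \<mu> = sets borel" using conv by (simp add: infinite_convolution_def)
  have fin: "finite ?I" using finite_digits by (intro finite_PiE) auto
  have "card (freq_level R L n) < card ?I"
    using freq_level_card(2)[where L=L and n=n, OF L(1)] card by (simp add: card_PiE)
  \<comment> \<open>The unknowns are indexed by digit words and the equations by the frequencies of
    level \<open>n\<close>.\<close>
  then obtain c where c: "\<exists>\<beta>\<in>?I. c \<beta> \<noteq> 0"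
    "\<And>l. l \<in> freq_level R L n \<Longrightarrow> (\<Sum>\<beta>\<in>?I. c \<beta> * exponential l (partial_series R n \<beta>)) = 0"
    using underdetermined_system[OF freq_level_card(1)[where L=L and n=n, OF L(1)] fin,
        where M="\<lambda>l \<beta>. exponential l (partial_series R n \<beta>)"] by blast
  \<comment> \<open>Conjugated weights, because the inner product conjugates \<open>f\<close>
    again.\<close>
  define f where "f x = (\<Sum>\<beta>\<in>?I. cnj (c \<beta>) * indicator (?cell \<beta>) x)" for x
  have "compact (?cell \<beta>)" for \<beta> by (intro compact_translation compact_tail_set)
  then have [measurable]: "?cell \<beta> \<in> sets borel" for \<beta> by (intro borel_compact)
  have fm [measurable]: "f \<in> borel_measurable borel" unfolding f_def[abs_def] by measurable
  have fb: "cmod (f x) \<le> (\<Sum>\<beta>\<in>?I. cmod (c \<beta>))" for x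
    unfolding f_def by (intro sum_norm_le) (auto simp: norm_mult indicator_def)
  have cells: "AE \<omega> in digit_space. \<forall>\<beta>\<in>?I. X \<omega> \<in> ?cell \<beta> \<longleftrightarrow> \<omega> \<in> cylinder n \<beta>"
    unfolding X_def using distinct by (rule cells_disjoint_AE[OF conv assms(2) _ \<open>n \<ge> 1\<close>])
  have fX: "AE \<omega> in digit_space. f (X \<omega>) = (\<Sum>\<beta>\<in>?I. cnj (c \<beta>) * indicator (cylinder n \<beta>) \<omega>)"
    using cells by eventually_elim (auto simp: f_def indicator_def intro!: sum.cong)
  have pc: "measure digit_space (cylinder n \<beta>) = p" if "\<beta> \<in> ?I" for \<beta>
    unfolding p_def using that by (intro measure_cylinder) auto
  have "p > 0" unfolding p_def
    using finite_digits zero_digit by (intro prod_pos) (auto simp: card_gt_0_iff)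
  show ?thesis
  proof (rule \<mu>.not_complete_in_L2I[where f=f])
    show "exponential l \<in> borel_measurable \<mu>" for l by measurable
    show "f \<in> borel_measurable \<mu>" by measurable
    show "cmod (f x) \<le> (\<Sum>\<beta>\<in>?I. cmod (c \<beta>))" for x by (rule fb)
    show "cmod (exponential l x) \<le> 1" for l and x :: "real^'n" by simp
  next
    \<comment> \<open>One cylinder with nonzero weight already bounds the squared norm of
      \<open>f\<close> from below.\<close>
    obtain \<beta> where \<beta>: "\<beta> \<in> ?I" "c \<beta> \<noteq> 0" using c(1) by blast
    have "0 < (cmod (c \<beta>))\<^sup>2 * p" using \<beta> \<open>p > 0\<close> by simp
    also have "\<dots> = (\<integral>\<omega>. (cmod (c \<beta>))\<^sup>2 * indicator (cylinder n \<beta>) \<omega> \<partial>digit_space)"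
      using pc[OF \<beta>(1)] by simp
    also have "\<dots> \<le> (\<integral>\<omega>. (cmod (f (X \<omega>)))\<^sup>2 \<partial>digit_space)"
    proof (rule integral_mono_AE)
      show "integrable digit_space (\<lambda>\<omega>. (cmod (c \<beta>))\<^sup>2 * indicator (cylinder n \<beta>) \<omega>)"
        by (intro integrable_mult_right integrable_real_indicator) (auto simp: less_top[symmetric])
      show "integrable digit_space (\<lambda>\<omega>. (cmod (f (X \<omega>)))\<^sup>2)"
      proof (rule digits.integrable_const_bound)
        show "AE \<omega> in digit_space. norm ((cmod (f (X \<omega>)))\<^sup>2) \<le> (\<Sum>\<beta>\<in>?I. cmod (c \<beta>))\<^sup>2"
          using fb by (simp add: power_mono)
      qed measurable
      show "AE \<omega> in digit_space. (cmod (c \<beta>))\<^sup>2 * indicator (cylinder n \<beta>) \<omega> \<le> (cmod (f (X \<omega>)))\<^sup>2"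
        using fX
      proof eventually_elim
        case (elim \<omega>)
        show ?case
        proof (cases "\<omega> \<in> cylinder n \<beta>")
          case True
          then have "\<omega> \<notin> cylinder n \<gamma>" if "\<gamma> \<in> ?I - {\<beta>}" for \<gamma>
            using that \<beta>(1) PiE_ext[of \<beta> "{1..n}" B \<gamma>] by (auto simp: cylinder_def)
          then have "(\<Sum>\<gamma>\<in>?I - {\<beta>}. cnj (c \<gamma>) * indicator (cylinder n \<gamma>) \<omega>) = 0"
            by (intro sum.neutral) auto
          then have "f (X \<omega>) = cnj (c \<beta>)"
            unfolding elim using True by (subst sum.remove[OF fin \<beta>(1)]) simp
          then show ?thesis using True by simp
        qed simp
      qed
    qed
    also have "\<dots> = (\<integral>x. (cmod (f x))\<^sup>2 \<partial>\<mu>)" unfolding \<mu> by (simp add: integral_distr)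
    finally show "(\<integral>x. (cmod (f x))\<^sup>2 \<partial>\<mu>) > 0" .
  next
    fix l assume "l \<in> freq_set R L"
    then obtain m where "l \<in> freq_level R L m" by (auto simp: freq_set_def)
    then obtain l' where l': "l' \<in> freq_level R L n"
      "\<And>\<beta>. exponential l (partial_series R n \<beta>) = exponential l' (partial_series R n \<beta>)"
      using freq_level_reduce[where L=L and n=n, OF _ L(2)] by blast
    define E where "E = (\<integral>\<omega>. exponential l (tail_series R n \<omega>) \<partial>digit_space)"
    let ?g = "\<lambda>\<beta> \<omega>. indicator (cylinder n \<beta>) \<omega> * exponential l (tail_series R n \<omega>)"
    have [measurable]: "tail_series R n \<in> borel_measurable digit_space"
      by (auto simp: digit_space_def intro!: measurable_digit_series)
    have g: "integrable digit_space (?g \<beta>)" for \<beta>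
      by (intro digits.integrable_const_bound[where B=1]) (auto simp: norm_mult indicator_def)
    have "(\<integral>x. cnj (f x) * exponential l x \<partial>\<mu>) = (\<integral>\<omega>. cnj (f (X \<omega>)) * exponential l (X \<omega>) \<partial>digit_space)"
      unfolding \<mu> by (rule integral_distr) measurable
    also have "\<dots> = (\<integral>\<omega>. (\<Sum>\<beta>\<in>?I. c \<beta> * exponential l (partial_series R n \<beta>) * ?g \<beta> \<omega>) \<partial>digit_space)"
    proof (rule integral_cong_AE)
      show "AE \<omega> in digit_space. cnj (f (X \<omega>)) * exponential l (X \<omega>) =
          (\<Sum>\<beta>\<in>?I. c \<beta> * exponential l (partial_series R n \<beta>) * ?g \<beta> \<omega>)"
        using fX AE_digits
      proof eventually_elim
        case (elim \<omega>)
        have "exponential l (X \<omega>) = exponential l (partial_series R n \<omega>) * exponential l (tail_series R n \<omega>)"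
          using partial_plus_tail[of \<omega> n] elim(2) by (simp add: X_def exponential_add_right)
        moreover have "partial_series R n \<omega> = partial_series R n \<beta>" if "\<omega> \<in> cylinder n \<beta>" for \<beta>
          using that by (simp add: partial_series_def cylinder_def)
        ultimately show ?case
          unfolding elim(1) by (auto simp: sum_distrib_right indicator_def intro!: sum.cong)
      qed
    qed measurable
    \<comment> \<open>All cylinders have the same mass \<open>p\<close>, and the tail factor
      \<open>E\<close> does not depend on \<open>\<beta>\<close>, so the linear relation for
      \<open>c\<close> can be factored out.\<close>
    also have "\<dots> = (\<Sum>\<beta>\<in>?I. c \<beta> * exponential l (partial_series R n \<beta>) * (of_real p * E))"
      using g by (subst Bochner_Integration.integral_sum)
        (auto simp: integral_cylinder_exponential pc E_def intro!: sum.cong integrable_mult_right)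
    also have "\<dots> = (\<Sum>\<beta>\<in>?I. c \<beta> * exponential l' (partial_series R n \<beta>)) * (of_real p * E)"
      by (simp add: sum_distrib_right l'(2))
    also have "\<dots> = 0" using c(2)[OF l'(1)] by simp
    finally show "(\<integral>x. cnj (f x) * exponential l x \<partial>\<mu>) = 0" .
  qed
qed

end

theorem theorem4p4:
  fixes R :: "nat \<Rightarrow> int ^ 'n ^ 'n"
    and B L :: "nat \<Rightarrow> (int ^ 'n) set"
    and \<mu> :: "(real ^ 'n) measure"
  assumes "riesz_tower R B L"
    and "digit_series_converge R B"
    and "infinite_convolution R B \<mu>"
    and "no_overlap R B \<mu>"
    and "\<forall>j\<ge>1. distinct_cosets (R j) (B j)"
    and "\<exists>j\<ge>1. card (L j) < card (B j)"
  shows "\<not> complete_in_L2 \<mu> (freq_set R L) exponential"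
proof -
  obtain C D where CD: "\<And>j. j \<ge> 1 \<Longrightarrow> 0 < C j"
    "\<And>j. j \<ge> 1 \<Longrightarrow> riesz_triple (R j) (B j) (L j) (C j) (D j)"
    using assms(1) unfolding riesz_tower_def by blast
  have triple: "expanding (R j)" "finite (B j)" "finite (L j)" "0 \<in> B j" "0 \<in> L j"
    if "j \<ge> 1" for j
    using CD(2)[OF that] by (auto simp: riesz_triple_def)
  interpret digit_system R B
    by unfold_locales (use triple assms(2) in auto)
  obtain n where n: "n \<ge> 1" "card (L n) < card (B n)" using assms(6) by blast
  show ?thesis
  proof (rule freq_set_not_complete[OF assms(3,4) _ n(1)])
    show "(\<Prod>k=1..n. card (L k)) < (\<Prod>k=1..n. card (B k))"
    \<comment> \<open>Factor \<open>n\<close> is strictly smaller by assumption, the others are at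
      most equal by the lower Riesz bounds, and the digit sets are nonempty.\<close>
    proof (rule prod_mono_strict[of n])
      show "0 \<le> card (L k) \<and> card (L k) \<le> card (B k)" if "k \<in> {1..n}" for k
        using that riesz_triple_card_le[OF CD(2,1), of k] by simp
      show "0 < card (B k)" if "k \<in> {1..n}" for k
        using that triple(2,4)[of k] by (auto simp: card_gt_0_iff)
    qed (use n in auto)
  qed (use assms(5) triple in auto)
qed

end
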